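(* Let $L$ be a complex Leibniz algebra whose corresponding Lie algebra $L/I$ is isomorphic to the complex Diamond Lie algebra $\mathfrak{D}_{\mathbb{C}}$ and whose ideal $I$, as a right $\mathfrak{D}_{\mathbb{C}}$-module, is the module with basis $\{X_1,X_2,X_3\}$ and action (omitted products are zero) $$\begin{array}{lll} (X_1,J)=\frac{2i}{3}X_1, & (X_2,J)=-\frac{i}{3}X_2, & (X_3,J)=-\frac{i}{3}X_3,\\ (X_1,P_+)=X_2, & (X_3,P_-)=X_1, & (X_3,T)=\frac{i}{2}X_2. \end{array}$$ Then $L$ admits a basis $\{J,P_+,P_-,T,X_1,X_2,X_3\}$ in which its table of multiplication is (omitted products are zero) $$L_1:\quad\begin{array}{lll} [J,P_+]=iP_+, & [J,P_-]=-iP_-, & [P_+,P_-]=2iT,\\ [P_+,J]=-iP_+, & [P_-,J]=iP_-, & [P_-,P_+]=-2iT,\\ [X_1,J]=\frac{2}{3}iX_1, & [X_2,J]=-\frac{1}{3}iX_2, & [X_3,J]=-\frac{1}{3}iX_3,\\ [X_1,P_+]=X_2, & [X_3,P_-]=X_1, & [X_3,T]=\frac{i}{2}X_2. \end{array}$$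
   Context: A Leibniz algebra over a field is a vector space $L$ with a bilinear product $[-,-]$ satisfying $[x,[y,z]]=[[x,y],z]-[[x,z],y]$ for all $x,y,z\in L$. For a Leibniz algebra $L$, $I$ denotes the ideal generated by the squares $[x,x]$, $x\in L$; it is contained in the right annihilator of $L$ (i.e. $[y,a]=0$ for all $y\in L$, $a\in I$). The quotient $\overline{L}=L/I$ is a Lie algebra, called the corresponding Lie algebra of $L$, and $I$ is a right $\overline{L}$-module via $(a,\overline{x})\mapsto[a,x]$. Right modules over a Lie algebra satisfy $(m,[x,y])=((m,x),y)-((m,y),x)$. The complex Diamond Lie algebra $\mathfrak{D}_{\mathbb{C}}$ is the four-dimensional complex Lie algebra with basis $\{J,P_+,P_-,T\}$ and nonzero brackets (up to antisymmetry) $[J,P_+]=iP_+$, $[J,P_-]=-iP_-$, $[P_+,P_-]=2iT$, where $i$ is the imaginary unit. *)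

theory Defs
  imports "HOL-Analysis.Analysis" "HOL-Library.Set_Algebras"
begin

text \<open>The quotient of an algebra by an ideal lives on a set of cosets, not on a whole type;
  this record holds a vector space with a product on such a carrier.\<close>

record ('k, 'a) alg =
  alg_carrier :: "'a set"
  alg_add :: "'a \<Rightarrow> 'a \<Rightarrow> 'a"
  alg_scale :: "'k \<Rightarrow> 'a \<Rightarrow> 'a"
  alg_bracket :: "'a \<Rightarrow> 'a \<Rightarrow> 'a"

definition alg_iso :: "('a \<Rightarrow> 'b) \<Rightarrow> ('k, 'a) alg \<Rightarrow> ('k, 'b) alg \<Rightarrow> bool" where
  "alg_iso \<phi> A B \<longleftrightarrow>
     bij_betw \<phi> (alg_carrier A) (alg_carrier B) \<and>
     (\<forall>x\<in>alg_carrier A. \<forall>y\<in>alg_carrier A.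
        \<phi> (alg_add A x y) = alg_add B (\<phi> x) (\<phi> y)) \<and>
     (\<forall>c. \<forall>x\<in>alg_carrier A. \<phi> (alg_scale A c x) = alg_scale B c (\<phi> x)) \<and>
     (\<forall>x\<in>alg_carrier A. \<forall>y\<in>alg_carrier A.
        \<phi> (alg_bracket A x y) = alg_bracket B (\<phi> x) (\<phi> y))"


locale leibniz_algebra = vector_space scale
  for scale :: "'k::field \<Rightarrow> 'a::ab_group_add \<Rightarrow> 'a" +
  fixes bracket :: "'a \<Rightarrow> 'a \<Rightarrow> 'a"
  assumes linear_left: "Vector_Spaces.linear scale scale (\<lambda>x. bracket x y)"
    and linear_right: "Vector_Spaces.linear scale scale (bracket x)"
    and leibniz: "bracket x (bracket y z) = bracket (bracket x y) z - bracket (bracket x z) y"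
begin

definition ideal :: "'a set \<Rightarrow> bool" where
  "ideal S \<longleftrightarrow> subspace S \<and> (\<forall>a\<in>S. \<forall>x. bracket a x \<in> S \<and> bracket x a \<in> S)"

definition leib_ideal :: "'a set" where
  "leib_ideal = ideal hull {bracket x x | x. True}"

definition coset :: "'a \<Rightarrow> 'a set" where
  "coset x = x +o leib_ideal"

text \<open>The operations on cosets are written without choosing representatives; the lemmas
  \<open>coset_add\<close>, \<open>coset_scale\<close> and \<open>coset_bracket\<close> below show that they are the induced ones.\<close>

definition corresponding_lie :: "('k, 'a set) alg" where
  "corresponding_lie =
     \<lparr>alg_carrier = range coset,
      alg_add = (\<lambda>A B. \<Union>a\<in>A. \<Union>b\<in>B. coset (a + b)),
      alg_scale = (\<lambda>c A. \<Union>a\<in>A. coset (scale c a)),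
      alg_bracket = (\<lambda>A B. \<Union>a\<in>A. \<Union>b\<in>B. coset (bracket a b))\<rparr>"

text \<open>Given an identification \<open>\<phi>\<close> of the corresponding Lie algebra with a Lie algebra on the
  type \<open>'d\<close>, the ideal is a right module over \<open>'d\<close> via \<open>(a, \<phi> (coset x)) \<mapsto> bracket a x\<close>.
  The predicate says that \<open>\<psi>\<close> is an isomorphism from this module onto the right module on the
  type \<open>'m\<close> with scalar multiplication \<open>mscale\<close> and action \<open>act\<close>.\<close>

definition ideal_module_iso ::
  "('a set \<Rightarrow> 'd) \<Rightarrow> ('k \<Rightarrow> 'm \<Rightarrow> 'm) \<Rightarrow> ('m \<Rightarrow> 'd \<Rightarrow> 'm) \<Rightarrow> ('a \<Rightarrow> 'm::ab_group_add) \<Rightarrow> bool" where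
  "ideal_module_iso \<phi> mscale act \<psi> \<longleftrightarrow>
     bij_betw \<psi> leib_ideal UNIV \<and>
     (\<forall>a\<in>leib_ideal. \<forall>b\<in>leib_ideal. \<psi> (a + b) = \<psi> a + \<psi> b) \<and>
     (\<forall>c. \<forall>a\<in>leib_ideal. \<psi> (scale c a) = mscale c (\<psi> a)) \<and>
     (\<forall>a\<in>leib_ideal. \<forall>x. \<psi> (bracket a x) = act (\<psi> a) (\<phi> (coset x)))"

definition basis_family :: "('i \<Rightarrow> 'a) \<Rightarrow> bool" where
  "basis_family e \<longleftrightarrow> inj e \<and> independent (range e) \<and> span (range e) = UNIV"

lemma bracket_add_left: "bracket (x + y) z = bracket x z + bracket y z"
  using linear_left[of z] by (simp add: Vector_Spaces.linear_iff)

lemma bracket_add_right: "bracket x (y + z) = bracket x y + bracket x z"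
  using linear_right[of x] by (simp add: Vector_Spaces.linear_iff)

lemma ideal_leib_ideal: "ideal leib_ideal"
  unfolding leib_ideal_def
  by (rule hull_in) (auto simp: ideal_def subspace_def)

lemma subspace_leib_ideal: "subspace leib_ideal"
  using ideal_leib_ideal by (simp add: ideal_def)

lemma bracket_leib_ideal:
  assumes "a \<in> leib_ideal" shows "bracket y a = 0"
proof -
  let ?A = "{a. \<forall>y. bracket y a = 0}"
  have zero: "bracket y 0 = 0" "bracket 0 y = 0" for y
    using bracket_add_right[of y 0 0] bracket_add_left[of 0 0 y] by simp_all
  have "bracket y (scale c a) = scale c (bracket y a)" for c y a
    using linear_right[of y] by (simp add: Vector_Spaces.linear_iff)
  then have "ideal ?A"
    by (auto simp: ideal_def subspace_def zero bracket_add_right leibniz)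
  moreover have "{bracket x x |x. True} \<subseteq> ?A"
    by (auto simp: leibniz)
  ultimately have "leib_ideal \<subseteq> ?A"
    unfolding leib_ideal_def by (rule hull_minimal[rotated])
  then show ?thesis
    using assms by auto
qed

lemma coset_absorb: "a \<in> leib_ideal \<Longrightarrow> coset (x + a) = coset x"
proof -
  assume a: "a \<in> leib_ideal"
  have "b \<in> leib_ideal \<Longrightarrow> \<exists>c\<in>leib_ideal. x + a + b = x + c" for b
    using subspace_add[OF subspace_leib_ideal a] by (metis add.assoc)
  moreover have "b \<in> leib_ideal \<Longrightarrow> \<exists>c\<in>leib_ideal. x + b = x + a + c" for b
    using subspace_diff[OF subspace_leib_ideal _ a, of b] by (intro bexI[of _ "b - a"]) auto
  ultimately show ?thesis
    unfolding coset_def elt_set_plus_def by auto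
qed

lemma coset_self: "x \<in> coset x"
  using subspace_0[OF subspace_leib_ideal] by (force simp: coset_def elt_set_plus_def)

lemma in_cosetE:
  assumes "y \<in> coset x" obtains a where "a \<in> leib_ideal" "y = x + a"
  using assms by (auto simp: coset_def elt_set_plus_def)

lemma coset_add:
  "alg_add corresponding_lie (coset x) (coset y) = coset (x + y)"
proof -
  have "coset (x' + y') = coset (x + y)" if "x' \<in> coset x" "y' \<in> coset y" for x' y'
  proof -
    obtain a b where ab: "a \<in> leib_ideal" "b \<in> leib_ideal" "x' = x + a" "y' = y + b"
      using \<open>x' \<in> coset x\<close> \<open>y' \<in> coset y\<close> by (metis in_cosetE)
    have "x' + y' = (x + y) + (a + b)"
      using ab by (simp add: algebra_simps)
    then show ?thesis
      using coset_absorb subspace_add[OF subspace_leib_ideal] ab by metis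
  qed
  then have "(\<Union>a\<in>coset x. \<Union>b\<in>coset y. coset (a + b)) = coset (x + y)"
    using coset_self[of x] coset_self[of y] by blast
  then show ?thesis
    by (simp add: corresponding_lie_def)
qed

lemma coset_scale:
  "alg_scale corresponding_lie c (coset x) = coset (scale c x)"
proof -
  have "coset (scale c x') = coset (scale c x)" if "x' \<in> coset x" for x'
  proof -
    obtain a where "a \<in> leib_ideal" "x' = x + a"
      using \<open>x' \<in> coset x\<close> by (rule in_cosetE)
    then show ?thesis
      by (simp add: scale_right_distrib coset_absorb subspace_scale[OF subspace_leib_ideal])
  qed
  then have "(\<Union>a\<in>coset x. coset (scale c a)) = coset (scale c x)"
    using coset_self[of x] by blast
  then show ?thesis
    by (simp add: corresponding_lie_def)
qed

lemma coset_bracket: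
  "alg_bracket corresponding_lie (coset x) (coset y) = coset (bracket x y)"
proof -
  have "coset (bracket x' y') = coset (bracket x y)" if "x' \<in> coset x" "y' \<in> coset y" for x' y'
  proof -
    obtain a b where ab: "a \<in> leib_ideal" "b \<in> leib_ideal" "x' = x + a" "y' = y + b"
      using \<open>x' \<in> coset x\<close> \<open>y' \<in> coset y\<close> by (metis in_cosetE)
    have eq: "bracket x' y' = bracket x y + (bracket x b + bracket a (y + b))"
      using ab by (simp add: bracket_add_left bracket_add_right algebra_simps)
    have "bracket x b + bracket a (y + b) \<in> leib_ideal"
      using ab ideal_leib_ideal by (intro subspace_add subspace_leib_ideal) (auto simp: ideal_def)
    then show ?thesis
      using coset_absorb eq by metis
  qed
  then have "(\<Union>a\<in>coset x. \<Union>b\<in>coset y. coset (bracket a b)) = coset (bracket x y)"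
    using coset_self[of x] coset_self[of y] by blast
  then show ?thesis
    by (simp add: corresponding_lie_def)
qed

end


datatype diamond_gen = D_J | D_Pp | D_Pm | D_T

lemma UNIV_diamond_gen: "(UNIV :: diamond_gen set) = {D_J, D_Pp, D_Pm, D_T}"
  using diamond_gen.exhaust by auto

instance diamond_gen :: finite
  by standard (simp add: UNIV_diamond_gen)

fun diamond_table :: "diamond_gen \<Rightarrow> diamond_gen \<Rightarrow> complex ^ diamond_gen" where
  "diamond_table D_J D_Pp = \<i> *s axis D_Pp 1"
| "diamond_table D_Pp D_J = - \<i> *s axis D_Pp 1"
| "diamond_table D_J D_Pm = - \<i> *s axis D_Pm 1"
| "diamond_table D_Pm D_J = \<i> *s axis D_Pm 1"
| "diamond_table D_Pp D_Pm = (2 * \<i>) *s axis D_T 1"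
| "diamond_table D_Pm D_Pp = - (2 * \<i>) *s axis D_T 1"
| "diamond_table _ _ = 0"

definition diamond_bracket ::
  "complex ^ diamond_gen \<Rightarrow> complex ^ diamond_gen \<Rightarrow> complex ^ diamond_gen" where
  "diamond_bracket x y = (\<Sum>u\<in>UNIV. \<Sum>v\<in>UNIV. (x $ u * y $ v) *s diamond_table u v)"

definition diamond :: "(complex, complex ^ diamond_gen) alg" where
  "diamond = \<lparr>alg_carrier = UNIV, alg_add = (+), alg_scale = (*s), alg_bracket = diamond_bracket\<rparr>"


datatype module_gen = M_X1 | M_X2 | M_X3

lemma UNIV_module_gen: "(UNIV :: module_gen set) = {M_X1, M_X2, M_X3}"
  using module_gen.exhaust by auto

instance module_gen :: finite
  by standard (simp add: UNIV_module_gen)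

fun action_table :: "module_gen \<Rightarrow> diamond_gen \<Rightarrow> complex ^ module_gen" where
  "action_table M_X1 D_J = (2 * \<i> / 3) *s axis M_X1 1"
| "action_table M_X2 D_J = - (\<i> / 3) *s axis M_X2 1"
| "action_table M_X3 D_J = - (\<i> / 3) *s axis M_X3 1"
| "action_table M_X1 D_Pp = axis M_X2 1"
| "action_table M_X3 D_Pm = axis M_X1 1"
| "action_table M_X3 D_T = (\<i> / 2) *s axis M_X2 1"
| "action_table _ _ = 0"

definition diamond_action ::
  "complex ^ module_gen \<Rightarrow> complex ^ diamond_gen \<Rightarrow> complex ^ module_gen" where
  "diamond_action m x = (\<Sum>u\<in>UNIV. \<Sum>v\<in>UNIV. (m $ u * x $ v) *s action_table u v)"

lemma diamond_bracket_nth: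
  "diamond_bracket x y $ D_J = 0"
  "diamond_bracket x y $ D_Pp = \<i> * (x $ D_J * y $ D_Pp - x $ D_Pp * y $ D_J)"
  "diamond_bracket x y $ D_Pm = - \<i> * (x $ D_J * y $ D_Pm - x $ D_Pm * y $ D_J)"
  "diamond_bracket x y $ D_T = 2 * \<i> * (x $ D_Pp * y $ D_Pm - x $ D_Pm * y $ D_Pp)"
  by (simp_all add: diamond_bracket_def UNIV_diamond_gen axis_def algebra_simps)

lemma diamond_action_nth:
  "diamond_action m x $ M_X1 = 2 * \<i> / 3 * m $ M_X1 * x $ D_J + m $ M_X3 * x $ D_Pm"
  "diamond_action m x $ M_X2 =
     - \<i> / 3 * m $ M_X2 * x $ D_J + m $ M_X1 * x $ D_Pp + \<i> / 2 * m $ M_X3 * x $ D_T"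
  "diamond_action m x $ M_X3 = - \<i> / 3 * m $ M_X3 * x $ D_J"
  by (simp_all add: diamond_action_def UNIV_diamond_gen UNIV_module_gen axis_def algebra_simps)

lemma vec_eq_diamond_gen:
  "(x :: complex ^ diamond_gen) = y \<longleftrightarrow>
     x $ D_J = y $ D_J \<and> x $ D_Pp = y $ D_Pp \<and> x $ D_Pm = y $ D_Pm \<and> x $ D_T = y $ D_T"
  by (metis (full_types) diamond_gen.exhaust vec_eq_iff)

lemma vec_eq_module_gen:
  "(x :: complex ^ module_gen) = y \<longleftrightarrow>
     x $ M_X1 = y $ M_X1 \<and> x $ M_X2 = y $ M_X2 \<and> x $ M_X3 = y $ M_X3"
  by (metis (full_types) module_gen.exhaust vec_eq_iff)

lemma leibniz_algebra_diamond: "leibniz_algebra (*s) diamond_bracket"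
proof (unfold_locales)
qed (simp_all add: vec_eq_diamond_gen diamond_bracket_nth algebra_simps)

lemma diamond_bracket_self: "diamond_bracket x x = 0"
  by (simp add: vec_eq_diamond_gen diamond_bracket_nth)

lemma diamond_action_right_module:
  "diamond_action m (diamond_bracket x y) =
     diamond_action (diamond_action m x) y - diamond_action (diamond_action m y) x"
  by (simp add: vec_eq_module_gen diamond_bracket_nth diamond_action_nth field_simps)


fun L1_table :: "(complex \<Rightarrow> 'a \<Rightarrow> 'a) \<Rightarrow> (diamond_gen + module_gen \<Rightarrow> 'a::ab_group_add) \<Rightarrow>
    diamond_gen + module_gen \<Rightarrow> diamond_gen + module_gen \<Rightarrow> 'a" where
  "L1_table sc e (Inl D_J) (Inl D_Pp) = sc \<i> (e (Inl D_Pp))"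
| "L1_table sc e (Inl D_J) (Inl D_Pm) = sc (- \<i>) (e (Inl D_Pm))"
| "L1_table sc e (Inl D_Pp) (Inl D_Pm) = sc (2 * \<i>) (e (Inl D_T))"
| "L1_table sc e (Inl D_Pp) (Inl D_J) = sc (- \<i>) (e (Inl D_Pp))"
| "L1_table sc e (Inl D_Pm) (Inl D_J) = sc \<i> (e (Inl D_Pm))"
| "L1_table sc e (Inl D_Pm) (Inl D_Pp) = sc (- (2 * \<i>)) (e (Inl D_T))"
| "L1_table sc e (Inr M_X1) (Inl D_J) = sc (2 / 3 * \<i>) (e (Inr M_X1))"
| "L1_table sc e (Inr M_X2) (Inl D_J) = sc (- (1 / 3) * \<i>) (e (Inr M_X2))"
| "L1_table sc e (Inr M_X3) (Inl D_J) = sc (- (1 / 3) * \<i>) (e (Inr M_X3))"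
| "L1_table sc e (Inr M_X1) (Inl D_Pp) = e (Inr M_X2)"
| "L1_table sc e (Inr M_X3) (Inl D_Pm) = e (Inr M_X1)"
| "L1_table sc e (Inr M_X3) (Inl D_T) = sc (\<i> / 2) (e (Inr M_X2))"
| "L1_table sc e _ _ = 0"

end

theory Submission
  imports Defs
begin

text \<open>Right multiplication by a lift \<open>j\<close> of \<open>J\<close> is a derivation of \<open>L\<close>. Its eigenvalues on \<open>I\<close> are
  \<open>2\<i>/3\<close> and \<open>-\<i>/3\<close>, while those on \<open>L/I\<close> are the integral multiples \<open>0, -\<i>, \<i>\<close> of \<open>\<i>\<close>.
  The two spectra being disjoint, every eigenvector of \<open>L/I\<close> lifts uniquely to one of \<open>L\<close>. Brackets
  of lifts have weights in \<open>\<int>\<i>\<close>, which meets the spectrum on \<open>I\<close> nowhere, so the lifts span a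
  subalgebra complementary to \<open>I\<close>, and the extension splits. Since \<open>I\<close> annihilates \<open>L\<close> from the right,
  replacing \<open>j\<close> by the weight-zero lift of \<open>J\<close> does not change the right multiplication.\<close>

section \<open>Right multiplications as derivations\<close>

context leibniz_algebra
begin

lemma bracket_scale_left: "bracket (scale c x) y = scale c (bracket x y)"
  using linear_left[of y] by (simp add: Vector_Spaces.linear_iff)

lemma bracket_scale_right: "bracket x (scale c y) = scale c (bracket x y)"
  using linear_right[of x] by (simp add: Vector_Spaces.linear_iff)

lemma bracket_diff_left: "bracket (x - y) z = bracket x z - bracket y z"
  by (metis bracket_add_left add_diff_cancel diff_add_cancel)

lemma bracket_minus_left: "bracket (- x) y = - bracket x y"
  using bracket_scale_left[of "- 1" x y] by simp

text \<open>The Leibniz identity rearranges to [[x,y],j] = [[x,j],y] + [x,[y,j]], so eigenvalues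
  add.\<close>

lemma bracket_eigenvectors:
  assumes "bracket x j = scale \<alpha> x" and "bracket y j = scale \<beta> y"
  shows "bracket (bracket x y) j = scale (\<alpha> + \<beta>) (bracket x y)"
  using leibniz[of x y j] assms
  by (simp add: bracket_scale_left bracket_scale_right algebra_simps)

end

section \<open>Coordinates on the quotient and on the ideal\<close>

locale diamond_extension = leibniz_algebra sc bracket
  for sc :: "complex \<Rightarrow> 'a::ab_group_add \<Rightarrow> 'a" and bracket +
  fixes \<phi> :: "'a set \<Rightarrow> complex ^ diamond_gen" and \<psi> :: "'a \<Rightarrow> complex ^ module_gen"
  assumes quotient_iso: "alg_iso \<phi> corresponding_lie diamond"
    and module_iso: "ideal_module_iso \<phi> (*s) diamond_action \<psi>"
begin

definition proj :: "'a \<Rightarrow> complex ^ diamond_gen" where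
  "proj x = \<phi> (coset x)"

lemma carrier_corresponding_lie: "alg_carrier corresponding_lie = range coset"
  by (simp add: corresponding_lie_def)

lemma proj_add: "proj (x + y) = proj x + proj y"
  using quotient_iso
  by (simp add: alg_iso_def proj_def carrier_corresponding_lie coset_add[symmetric] diamond_def)

lemma proj_scale: "proj (sc c x) = c *s proj x"
  using quotient_iso
  by (simp add: alg_iso_def proj_def carrier_corresponding_lie coset_scale[symmetric] diamond_def)

lemma proj_bracket: "proj (bracket x y) = diamond_bracket (proj x) (proj y)"
  using quotient_iso
  by (simp add: alg_iso_def proj_def carrier_corresponding_lie coset_bracket[symmetric] diamond_def)

lemma proj_0: "proj 0 = 0"
  using proj_add[of 0 0] by simp

lemma proj_diff: "proj (x - y) = proj x - proj y"
  by (metis proj_add add_diff_cancel diff_add_cancel)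

lemma proj_minus: "proj (- x) = - proj x"
  using proj_diff[of 0 x] by (simp add: proj_0)

lemma proj_sum: "proj (sum f A) = (\<Sum>i\<in>A. proj (f i))"
  by (induction A rule: infinite_finite_induct) (simp_all add: proj_0 proj_add)

lemma obtain_proj: obtains x where "proj x = d"
proof -
  have "\<phi> ` range coset = UNIV"
    using quotient_iso by (simp add: alg_iso_def bij_betw_def carrier_corresponding_lie diamond_def)
  then have "d \<in> \<phi> ` range coset"
    by simp
  then show ?thesis
    using that by (auto simp: proj_def)
qed

text \<open>Since \<open>\<phi>\<close> is injective on cosets, the kernel of \<open>proj\<close> is
  the coset of 0. Membership in the ideal thereby becomes a computation in the Diamond
  algebra.\<close>

lemma proj_eq_0_iff: "proj x = 0 \<longleftrightarrow> x \<in> leib_ideal"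
proof
  assume "proj x = 0"
  then have "\<phi> (coset x) = \<phi> (coset 0)"
    using proj_0 by (simp add: proj_def)
  then have "coset x = coset 0"
    using quotient_iso
    by (auto simp: alg_iso_def bij_betw_def inj_on_def carrier_corresponding_lie)
  then have "x \<in> coset 0"
    using coset_self[of x] by simp
  then show "x \<in> leib_ideal"
    by (auto elim: in_cosetE)
next
  assume "x \<in> leib_ideal"
  then show "proj x = 0"
    using coset_absorb[of x 0] proj_0 by (simp add: proj_def)
qed

lemma psi_add: "a \<in> leib_ideal \<Longrightarrow> b \<in> leib_ideal \<Longrightarrow> \<psi> (a + b) = \<psi> a + \<psi> b"
  using module_iso by (simp add: ideal_module_iso_def)

lemma psi_scale: "a \<in> leib_ideal \<Longrightarrow> \<psi> (sc c a) = c *s \<psi> a"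
  using module_iso by (simp add: ideal_module_iso_def)

lemma psi_bracket: "a \<in> leib_ideal \<Longrightarrow> \<psi> (bracket a x) = diamond_action (\<psi> a) (proj x)"
  using module_iso by (simp add: ideal_module_iso_def proj_def)

lemma psi_inject: "a \<in> leib_ideal \<Longrightarrow> b \<in> leib_ideal \<Longrightarrow> \<psi> a = \<psi> b \<longleftrightarrow> a = b"
  using module_iso by (auto simp: ideal_module_iso_def bij_betw_def inj_on_def)

lemma obtain_psi: obtains a where "a \<in> leib_ideal" "\<psi> a = m"
proof -
  have "\<psi> ` leib_ideal = UNIV"
    using module_iso by (simp add: ideal_module_iso_def bij_betw_def)
  then have "m \<in> \<psi> ` leib_ideal"
    by simp
  then show ?thesis
    using that by auto
qed

lemma zero_in_leib_ideal: "0 \<in> leib_ideal"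
  using subspace_0[OF subspace_leib_ideal] .

lemma scale_in_leib_ideal: "a \<in> leib_ideal \<Longrightarrow> sc c a \<in> leib_ideal"
  using subspace_scale[OF subspace_leib_ideal] .

lemma bracket_in_leib_ideal: "a \<in> leib_ideal \<Longrightarrow> bracket a x \<in> leib_ideal"
  using ideal_leib_ideal by (simp add: ideal_def)

lemma psi_0: "\<psi> 0 = 0"
  using psi_add[OF zero_in_leib_ideal zero_in_leib_ideal] by simp

lemma psi_minus: "a \<in> leib_ideal \<Longrightarrow> \<psi> (- a) = - \<psi> a"
  using psi_scale[of a "- 1"] by simp

lemma psi_sum: "(\<And>i. i \<in> A \<Longrightarrow> f i \<in> leib_ideal) \<Longrightarrow> \<psi> (sum f A) = (\<Sum>i\<in>A. \<psi> (f i))"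
proof (induction A rule: infinite_finite_induct)
  case (insert i A)
  then have "sum f A \<in> leib_ideal"
    by (intro subspace_sum subspace_leib_ideal) auto
  then show ?case
    using insert by (simp add: psi_add)
qed (simp_all add: psi_0)

section \<open>Lifting eigenvectors of right multiplication by J\<close>

text \<open>The eigenvalue condition excludes the weights \<open>2\<i>/3\<close> and \<open>-\<i>/3\<close> of the ideal.\<close>

lemma ideal_eigenvector_eq_0:
  assumes "proj j = axis D_J 1" and "\<alpha> \<notin> {2 * \<i> / 3, - \<i> / 3}"
    and "a \<in> leib_ideal" and "bracket a j = sc \<alpha> a"
  shows "a = 0"
proof -
  have "diamond_action (\<psi> a) (axis D_J 1) = \<alpha> *s \<psi> a"
    using psi_bracket[of a j] psi_scale[of a \<alpha>] assms by simp
  \<comment> \<open>J acts diagonally on the ideal. The double minus makes a vanishing factor read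
    \<open>\<alpha> = - \<i> / 3\<close>, literally an excluded value.\<close>
  then have "(\<alpha> - 2 * \<i> / 3) * \<psi> a $ M_X1 = 0" "(\<alpha> - - \<i> / 3) * \<psi> a $ M_X2 = 0"
    "(\<alpha> - - \<i> / 3) * \<psi> a $ M_X3 = 0"
    by (auto simp: vec_eq_module_gen diamond_action_nth axis_def algebra_simps add_eq_0_iff2)
  then have "\<psi> a = 0"
    using assms(2) unfolding mult_eq_0_iff right_minus_eq by (simp add: vec_eq_module_gen)
  then show ?thesis
    using psi_inject[of a 0] assms(3) by (simp add: psi_0 zero_in_leib_ideal)
qed

text \<open>The difference is an eigenvector inside the ideal for an eigenvalue that does not occur
  there. Identities between eigenvectors can thus be checked in the quotient.\<close>

lemma eigenvector_eqI:
  assumes "proj j = axis D_J 1" and "\<alpha> \<notin> {2 * \<i> / 3, - \<i> / 3}"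
    and "bracket x j = sc \<alpha> x" and "bracket y j = sc \<alpha> y" and "proj x = proj y"
  shows "x = y"
proof -
  have "x - y \<in> leib_ideal"
    using assms(5) by (simp add: proj_diff flip: proj_eq_0_iff)
  moreover have "bracket (x - y) j = sc \<alpha> (x - y)"
    using assms by (simp add: bracket_diff_left scale_right_diff_distrib)
  ultimately show ?thesis
    using ideal_eigenvector_eq_0[OF assms(1,2)] by (metis right_minus_eq)
qed

text \<open>An arbitrary lift x fails to be an eigenvector by some b in the ideal. Subtracting a
  from x repairs this when [a,j] - \<alpha>a = b, which is solvable because \<alpha> is not an
  eigenvalue on the ideal.\<close>

lemma obtain_eigenvector_lift:
  assumes "proj j = axis D_J 1" and "\<alpha> \<notin> {2 * \<i> / 3, - \<i> / 3}"
    and "diamond_bracket d (axis D_J 1) = \<alpha> *s d"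
  obtains x where "proj x = d" "bracket x j = sc \<alpha> x"
proof -
  obtain x where x: "proj x = d"
    by (rule obtain_proj)
  define b where "b = bracket x j - sc \<alpha> x"
  have b: "b \<in> leib_ideal"
    using assms x by (simp add: b_def proj_diff proj_bracket proj_scale flip: proj_eq_0_iff)
  \<comment> \<open>Coordinates of the solution a: those of b, divided by the diagonal entries of
    the action of J minus \<alpha>.\<close>
  define m :: "complex ^ module_gen" where
    "m = (\<chi> u. \<psi> b $ u / ((if u = M_X1 then 2 * \<i> / 3 else - \<i> / 3) - \<alpha>))"
  obtain a where a: "a \<in> leib_ideal" "\<psi> a = m"
    by (rule obtain_psi)
  have "2 * \<i> / 3 - \<alpha> \<noteq> 0" "- \<i> / 3 - \<alpha> \<noteq> 0"
    using assms(2) by (metis insertCI right_minus_eq)+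
  then have "\<psi> b $ M_X1 = (2 * \<i> / 3 - \<alpha>) * m $ M_X1" "\<psi> b $ M_X2 = (- \<i> / 3 - \<alpha>) * m $ M_X2"
    "\<psi> b $ M_X3 = (- \<i> / 3 - \<alpha>) * m $ M_X3"
    unfolding m_def by (simp_all del: right_minus_eq)
  then have "\<psi> (bracket a j) = \<psi> (b + sc \<alpha> a)"
    using assms(1) a b
    by (simp add: psi_bracket psi_add psi_scale scale_in_leib_ideal vec_eq_module_gen
        diamond_action_nth axis_def) (simp add: algebra_simps)
  then have "bracket a j = b + sc \<alpha> a"
    using a b by (simp add: psi_inject bracket_in_leib_ideal scale_in_leib_ideal
        subspace_add[OF subspace_leib_ideal])
  then have "bracket (x - a) j = sc \<alpha> (x - a)"
    by (simp add: bracket_diff_left b_def scale_right_diff_distrib algebra_simps)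
  moreover have "proj (x - a) = d"
    using a x by (simp add: proj_diff proj_eq_0_iff[THEN iffD2])
  ultimately show ?thesis
    using that by blast
qed

text \<open>Eigenvalues of bracketing with J on the right, hence the sign in [P_+,J] =
  -iP_+.\<close>

fun weight :: "diamond_gen \<Rightarrow> complex" where
  "weight D_J = 0"
| "weight D_Pp = - \<i>"
| "weight D_Pm = \<i>"
| "weight D_T = 0"

text \<open>Sums of two weights are integral multiples of i, and the excluded values are
  not.\<close>

lemma weight_add_notin: "weight u + weight v \<notin> {2 * \<i> / 3, - \<i> / 3}"
  by (cases u; cases v) (auto simp: complex_eq_iff)

lemma weight_notin: "weight u \<notin> {2 * \<i> / 3, - \<i> / 3}"
  using weight_add_notin[of u D_J] by simp

text \<open>Eigenvectors are first found for any lift j of J, then j is replaced by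
  \<open>s D_J\<close>. For u = \<open>D_J\<close> the second property becomes [J,J] = 0.\<close>

lemma obtain_weight_lifts:
  obtains s where "\<And>u. proj (s u) = axis u 1" "\<And>u. bracket (s u) (s D_J) = sc (weight u) (s u)"
proof -
  obtain j where j: "proj j = axis D_J 1"
    by (rule obtain_proj)
  have "diamond_bracket (axis u 1) (axis D_J 1) = weight u *s axis u 1" for u
    by (cases u) (simp_all add: vec_eq_diamond_gen diamond_bracket_nth axis_def)
  then have "\<exists>x. proj x = axis u 1 \<and> bracket x j = sc (weight u) x" for u
    by (meson obtain_eigenvector_lift[OF j weight_notin])
  then obtain s where s: "\<And>u. proj (s u) = axis u 1" "\<And>u. bracket (s u) j = sc (weight u) (s u)"
    by metis
  have "s D_J - j \<in> leib_ideal"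
    by (simp add: s j proj_diff flip: proj_eq_0_iff)
  then have "bracket x (s D_J) = bracket x j" for x
    using bracket_add_right[of x j "s D_J - j"] by (simp add: bracket_leib_ideal)
  then show ?thesis
    using s that by metis
qed

section \<open>A basis adapted to the extension\<close>

text \<open>A lifted basis of the quotient together with a basis of the ideal: \<open>proj\<close>
  reads off the coefficients of \<open>s\<close>, and once these are removed, \<open>\<psi>\<close>
  reads off those of \<open>t\<close>.\<close>

lemma basis_familyI:
  assumes s: "\<And>u. proj (s u) = axis u 1"
    and t: "\<And>m. t m \<in> leib_ideal" "\<And>m. \<psi> (t m) = axis m 1"
  shows "basis_family (case_sum s t)"
proof -
  let ?e = "case_sum s t"
  have t0: "proj (t m) = 0" for m
    by (simp add: proj_eq_0_iff t)
  have ax: "(axis u 1 :: complex ^ 'n) = axis v 1 \<longleftrightarrow> u = v" for u v :: "'n::finite"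
    by (simp add: axis_eq_axis)
  have "inj s" "inj t"
    by (metis injI s ax) (metis injI t(2) ax)
  moreover have "s u \<noteq> t m" for u m
    using s[of u] t0[of m] by (metis axis_eq_0_iff zero_neq_one)
  ultimately have inj: "inj ?e"
    by (auto simp: inj_def split: sum.splits) metis
  have split: "(\<Sum>i\<in>UNIV. sc (c i) (?e i)) =
      (\<Sum>u\<in>UNIV. sc (c (Inl u)) (s u)) + (\<Sum>m\<in>UNIV. sc (c (Inr m)) (t m))" for c
    by (simp add: sum.Plus flip: UNIV_Plus_UNIV)
  have projs: "proj (\<Sum>u\<in>UNIV. sc (d u) (s u)) = (\<chi> u. d u)" for d
    by (simp add: proj_sum proj_scale s vec_eq_iff axis_def if_distrib cong: if_cong)
  have tin: "(\<Sum>m\<in>UNIV. sc (d m) (t m)) \<in> leib_ideal" for d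
    by (intro subspace_sum subspace_leib_ideal scale_in_leib_ideal t)
  have psit: "\<psi> (\<Sum>m\<in>UNIV. sc (d m) (t m)) = (\<chi> m. d m)" for d
    by (simp add: psi_sum psi_scale scale_in_leib_ideal t vec_eq_iff axis_def if_distrib
        cong: if_cong)
  have zero: "c i = 0" if c: "(\<Sum>i\<in>UNIV. sc (c i) (?e i)) = 0" for c i
  proof -
    have "(\<chi> u. c (Inl u)) = (0 :: complex ^ diamond_gen)"
      using arg_cong[OF c, of proj] tin
      by (simp add: split proj_add projs proj_0 proj_eq_0_iff[THEN iffD2])
    then have l: "c (Inl u) = 0" for u
      by (simp add: vec_eq_iff)
    then have "(\<Sum>m\<in>UNIV. sc (c (Inr m)) (t m)) = 0"
      using c by (simp add: split)
    then have "(\<chi> m. c (Inr m)) = (0 :: complex ^ module_gen)"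
      using psit[of "\<lambda>m. c (Inr m)"] by (simp add: psi_0)
    then have "c (Inr m) = 0" for m
      by (simp add: vec_eq_iff)
    with l show ?thesis
      by (cases i) auto
  qed
  have "independent (range ?e)"
  proof (rule independent_if_scalars_zero)
    fix f x assume f: "(\<Sum>x\<in>range ?e. sc (f x) x) = 0" and "x \<in> range ?e"
    then obtain i where "x = ?e i"
      by blast
    moreover have "(\<Sum>i\<in>UNIV. sc (f (?e i)) (?e i)) = 0"
      using f by (simp add: sum.reindex[OF inj])
    ultimately show "f x = 0"
      using zero[of "\<lambda>i. f (?e i)" i] by simp
  qed simp
  moreover have "x \<in> span (range ?e)" for x
  proof -
    define r where "r = x - (\<Sum>u\<in>UNIV. sc (proj x $ u) (s u))"
    have "r \<in> leib_ideal"
      by (simp add: r_def proj_diff projs flip: proj_eq_0_iff)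
    then have "r = (\<Sum>m\<in>UNIV. sc (\<psi> r $ m) (t m))"
      using psi_inject[of r "\<Sum>m\<in>UNIV. sc (\<psi> r $ m) (t m)"] tin by (simp add: psit)
    then have "x = (\<Sum>u\<in>UNIV. sc (proj x $ u) (s u)) + (\<Sum>m\<in>UNIV. sc (\<psi> r $ m) (t m))"
      by (simp add: r_def algebra_simps)
    moreover have "s u \<in> range ?e" "t m \<in> range ?e" for u m
      by (metis old.sum.simps(5) rangeI) (metis old.sum.simps(6) rangeI)
    ultimately show ?thesis
      by (metis (no_types, lifting) span_add span_sum span_scale span_base)
  qed
  ultimately show ?thesis
    using inj by (auto simp: basis_family_def)
qed

section \<open>The multiplication table\<close>

text \<open>Both sides have the same image in the quotient and the same eigenvalue, so the bracket
  has no component in the ideal.\<close>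

lemma bracket_weight_lifts:
  assumes s: "\<And>u. proj (s u) = axis u 1" "\<And>u. bracket (s u) (s D_J) = sc (weight u) (s u)"
  shows "bracket (s u) (s v) = L1_table sc (case_sum s t) (Inl u) (Inl v)"
proof (rule eigenvector_eqI[OF s(1) weight_add_notin])
  show "bracket (bracket (s u) (s v)) (s D_J) = sc (weight u + weight v) (bracket (s u) (s v))"
    using s(2) by (rule bracket_eigenvectors) (rule s(2))
  have "bracket 0 x = 0" for x
    using bracket_scale_left[of 0 0 x] by simp
  then show "bracket (L1_table sc (case_sum s t) (Inl u) (Inl v)) (s D_J) =
      sc (weight u + weight v) (L1_table sc (case_sum s t) (Inl u) (Inl v))"
    \<comment> \<open>Each nonzero entry is a multiple of a lift of weight exactly
      \<open>weight u + weight v\<close>; for instance T has weight 0 = -i + i.\<close>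
    by (cases u; cases v) (simp_all add: bracket_scale_left bracket_minus_left s(2))
  show "proj (bracket (s u) (s v)) = proj (L1_table sc (case_sum s t) (Inl u) (Inl v))"
    by (cases u; cases v) (simp_all add: proj_bracket proj_scale proj_minus proj_0 s(1) vec_eq_diamond_gen
        diamond_bracket_nth axis_def)
qed

lemma bracket_ideal_lift:
  assumes s: "\<And>u. proj (s u) = axis u 1"
    and t: "\<And>m. t m \<in> leib_ideal" "\<And>m. \<psi> (t m) = axis m 1"
  shows "bracket (t m) (s u) = L1_table sc (case_sum s t) (Inr m) (Inl u)" (is "_ = ?r")
proof -
  \<comment> \<open>Needed first, since \<open>\<psi>\<close> is known to be injective only on the
    ideal.\<close>
  have "?r \<in> leib_ideal"
    by (cases m; cases u) (simp_all add: t scale_in_leib_ideal zero_in_leib_ideal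
        subspace_neg[OF subspace_leib_ideal])
  moreover have "\<psi> (bracket (t m) (s u)) = \<psi> ?r"
    by (cases m; cases u) (simp_all add: psi_bracket psi_scale psi_minus psi_0 scale_in_leib_ideal s t vec_eq_module_gen
        diamond_action_nth axis_def)
  ultimately show ?thesis
    by (simp add: psi_inject bracket_in_leib_ideal t)
qed

lemma L1_basis:
  "\<exists>e. basis_family e \<and> (\<forall>u v. bracket (e u) (e v) = L1_table sc e u v)"
proof -
  obtain s where s: "\<And>u. proj (s u) = axis u 1" "\<And>u. bracket (s u) (s D_J) = sc (weight u) (s u)"
    using obtain_weight_lifts by blast
  have "\<exists>a. a \<in> leib_ideal \<and> \<psi> a = axis m 1" for m
    by (meson obtain_psi)
  then obtain t where t: "\<And>m. t m \<in> leib_ideal" "\<And>m. \<psi> (t m) = axis m 1"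
    by metis
  let ?e = "case_sum s t"
  have "bracket (?e u) (?e v) = L1_table sc ?e u v" for u v
  proof (cases v)
    case (Inl v')
    then show ?thesis
      using bracket_weight_lifts[OF s] bracket_ideal_lift[OF s(1) t] by (cases u) simp_all
  next
    \<comment> \<open>The ideal annihilates everything from the right, in agreement with the default
      value 0 of \<open>L1_table\<close>.\<close>
    case (Inr m)
    then show ?thesis
      by (cases u) (simp_all add: bracket_leib_ideal t)
  qed
  then show ?thesis
    using basis_familyI[OF s(1) t] by blast
qed

end

theorem theorem1:
  fixes sc :: "complex \<Rightarrow> 'a::ab_group_add \<Rightarrow> 'a"
    and bracket :: "'a \<Rightarrow> 'a \<Rightarrow> 'a"
    and \<phi> :: "'a set \<Rightarrow> complex ^ diamond_gen"
    and \<psi> :: "'a \<Rightarrow> complex ^ module_gen"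
  assumes "leibniz_algebra sc bracket"
    and "alg_iso \<phi> (leibniz_algebra.corresponding_lie sc bracket) diamond"
    and "leibniz_algebra.ideal_module_iso sc bracket \<phi> (*s) diamond_action \<psi>"
  shows "\<exists>e :: diamond_gen + module_gen \<Rightarrow> 'a.
           leibniz_algebra.basis_family sc e \<and>
           (\<forall>u v. bracket (e u) (e v) = L1_table sc e u v)"
proof -
  interpret diamond_extension sc bracket \<phi> \<psi>
    using assms by (simp add: diamond_extension_def diamond_extension_axioms_def)
  show ?thesis
    by (rule L1_basis)
qed

end
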